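(* Let $G$ be a wheel-free graph of order $n\geq 4$. Then $$\rho_Q(G)\leq \rho_Q(K_2\nabla (n-2)K_1)=\frac{n+2+\sqrt{(n+2)^2-16}}{2},$$ with equality holding if and only if $G=K_2\nabla (n-2)K_1$ (equality of graphs meaning isomorphism).
   Context: All graphs are finite, simple and undirected; the order of a graph is its number of vertices. The signless Laplacian matrix of $G$ is $Q(G)=D(G)+A(G)$, where $A(G)$ is the adjacency matrix and $D(G)$ is the diagonal matrix of vertex degrees; $\rho_Q(G)$ denotes the largest eigenvalue of $Q(G)$. $K_n$ and $C_n$ denote the complete graph and the cycle on $n$ vertices. $kG$ is the disjoint union of $k$ copies of $G$, and $G\nabla H$ is the graph obtained from the disjoint union of $G$ and $H$ by adding all edges between $G$ and $H$; $K_2\nabla (n-2)K_1$ means $K_2\nabla ((n-2)K_1)$. For $\ell\geq 4$, the wheel graph on $\ell$ vertices is $W_\ell=K_1\nabla C_{\ell-1}$ (so $W_4=K_4$). A graph is wheel-free if it does not contain any $W_\ell$, $\ell\ge 4$, as a (not necessarily induced) subgraph. *)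

theory Defs
  imports "Graph_Theory.Graph_Theory" "Jordan_Normal_Form.Spectral_Radius"
begin

text \<open>
  Finite simple undirected graphs are the \<^locale>\<open>pair_graph\<close>s of the Graph Theory library: finite,
  loop-free, and with a symmetric set of arcs, so that an edge \<open>uv\<close> is represented by the two arcs
  \<open>(u, v)\<close> and \<open>(v, u)\<close>.
\<close>

definition complete_graph :: "nat \<Rightarrow> nat pair_pre_digraph" where
  "complete_graph n = \<lparr> pverts = {..<n}, parcs = {(i, j). i < n \<and> j < n \<and> i \<noteq> j} \<rparr>"

text \<open>Only a cycle for \<open>n \<ge> 3\<close>.\<close>

definition cycle_graph :: "nat \<Rightarrow> nat pair_pre_digraph" where
  "cycle_graph n = \<lparr> pverts = {..<n},
     parcs = {(i, j). i < n \<and> j < n \<and> (j = Suc i mod n \<or> i = Suc j mod n)} \<rparr>"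

definition copies :: "nat \<Rightarrow> 'a pair_pre_digraph \<Rightarrow> (nat \<times> 'a) pair_pre_digraph" where
  "copies k G = \<lparr> pverts = {..<k} \<times> pverts G,
     parcs = {((i, u), (j, v)). i < k \<and> i = j \<and> (u, v) \<in> parcs G} \<rparr>"

definition graph_join ::
    "'a pair_pre_digraph \<Rightarrow> 'b pair_pre_digraph \<Rightarrow> ('a + 'b) pair_pre_digraph" (infixr \<open>\<nabla>\<close> 65) where
  "G \<nabla> H = \<lparr> pverts = pverts G <+> pverts H,
     parcs = map_prod Inl Inl ` parcs G \<union> map_prod Inr Inr ` parcs H
       \<union> Inl ` pverts G \<times> Inr ` pverts H \<union> Inr ` pverts H \<times> Inl ` pverts G \<rparr>"

definition wheel :: "nat \<Rightarrow> (nat + nat) pair_pre_digraph" where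
  "wheel l = complete_graph 1 \<nabla> cycle_graph (l - 1)"

definition graph_iso :: "'a pair_pre_digraph \<Rightarrow> 'b pair_pre_digraph \<Rightarrow> bool" where
  "graph_iso G H \<longleftrightarrow> digraph_iso (with_proj G) (with_proj H)"

definition contains_graph :: "'a pair_pre_digraph \<Rightarrow> 'b pair_pre_digraph \<Rightarrow> bool" where
  "contains_graph G F \<longleftrightarrow> (\<exists>H. subgraph (with_proj H) (with_proj G) \<and> graph_iso H F)"

definition wheel_free :: "'a pair_pre_digraph \<Rightarrow> bool" where
  "wheel_free G \<longleftrightarrow> (\<forall>l\<ge>4. \<not> contains_graph G (wheel l))"

text \<open>
  Rows and columns of the matrices are indexed by positions in an enumeration \<open>vs\<close> of the vertex
  set. Changing the enumeration permutes rows and columns simultaneously, hence does not change the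
  spectrum; see \<open>eigenvalue_signless_laplacian\<close> below.
\<close>

definition adjacency_matrix :: "'a pair_pre_digraph \<Rightarrow> 'a list \<Rightarrow> real mat" where
  "adjacency_matrix G vs = mat (length vs) (length vs)
     (\<lambda>(i, j). if (vs ! i, vs ! j) \<in> parcs G then 1 else 0)"

definition degree_matrix :: "'a pair_pre_digraph \<Rightarrow> 'a list \<Rightarrow> real mat" where
  "degree_matrix G vs = mat_diag (length vs) (\<lambda>i. real (out_degree (with_proj G) (vs ! i)))"

definition signless_laplacian :: "'a pair_pre_digraph \<Rightarrow> 'a list \<Rightarrow> real mat" where
  "signless_laplacian G vs = degree_matrix G vs + adjacency_matrix G vs"

definition vertex_list :: "'a pair_pre_digraph \<Rightarrow> 'a list" where
  "vertex_list G = (SOME vs. distinct vs \<and> set vs = pverts G)"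

text \<open>The matrix is real symmetric, so its real eigenvalues are all its eigenvalues.\<close>

definition rho_Q :: "'a pair_pre_digraph \<Rightarrow> real" where
  "rho_Q G = Max (spectrum (signless_laplacian G (vertex_list G)))"

lemma vertex_list:
  assumes "finite (pverts G)"
  shows "distinct (vertex_list G)" "set (vertex_list G) = pverts G"
  using someI_ex[of "\<lambda>vs. distinct vs \<and> set vs = pverts G"] finite_distinct_list[OF assms]
  unfolding vertex_list_def by blast+

lemma signless_laplacian_carrier:
  "signless_laplacian G vs \<in> carrier_mat (length vs) (length vs)"
  by (simp add: signless_laplacian_def adjacency_matrix_def)

lemma signless_laplacian_index:
  assumes "i < length vs" "j < length vs"
  shows "signless_laplacian G vs $$ (i, j) =
    (if i = j then real (out_degree (with_proj G) (vs ! i)) else 0)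
      + (if (vs ! i, vs ! j) \<in> parcs G then 1 else 0)"
  using assms
  by (simp add: signless_laplacian_def adjacency_matrix_def degree_matrix_def mat_diag_def)

lemma eigenvalue_signless_laplacian_imp:
  assumes d: "distinct us" "distinct vs" "set us = set vs"
    and e: "eigenvalue (signless_laplacian G us) k"
  shows "eigenvalue (signless_laplacian G vs) k"
proof -
  let ?n = "length us"
  have n: "length vs = ?n" using d by (metis distinct_card)
  have "\<forall>j<?n. \<exists>i<?n. us ! i = vs ! j"
    using d n by (metis in_set_conv_nth)
  then obtain p where p: "\<And>j. j < ?n \<Longrightarrow> p j < ?n \<and> us ! p j = vs ! j" by metis
  have inj: "p i = p j \<longleftrightarrow> i = j" if "i < ?n" "j < ?n" for i j
    using that p d(2) n by (metis nth_eq_iff_index_eq)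
  have bij: "bij_betw p {..<?n} {..<?n}"
  proof -
    have "inj_on p {..<?n}" using inj by (auto simp: inj_on_def)
    moreover have "p ` {..<?n} \<subseteq> {..<?n}" using p by auto
    ultimately show ?thesis by (simp add: bij_betw_def endo_inj_surj)
  qed
  let ?A = "signless_laplacian G us" and ?B = "signless_laplacian G vs"
  have A: "?A \<in> carrier_mat ?n ?n" and B: "?B \<in> carrier_mat ?n ?n"
    using signless_laplacian_carrier[of G us] signless_laplacian_carrier[of G vs] n by auto
  obtain x where x: "x \<in> carrier_vec ?n" "x \<noteq> 0\<^sub>v ?n" "?A *\<^sub>v x = k \<cdot>\<^sub>v x"
    using e A unfolding eigenvalue_def eigenvector_def by auto
  define y where "y = vec ?n (\<lambda>i. x $ p i)"
  have BA: "?B $$ (i, j) = ?A $$ (p i, p j)" if "i < ?n" "j < ?n" for i j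
    using that p n inj by (simp add: signless_laplacian_index)
  have "?B *\<^sub>v y = k \<cdot>\<^sub>v y"
  proof (rule eq_vecI)
    fix i assume "i < dim_vec (k \<cdot>\<^sub>v y)"
    then have i: "i < ?n" by (simp add: y_def)
    have "(?B *\<^sub>v y) $ i = (\<Sum>j<?n. ?B $$ (i, j) * x $ p j)"
      using i B by (simp add: scalar_prod_def y_def lessThan_atLeast0)
    also have "\<dots> = (\<Sum>j<?n. ?A $$ (p i, p j) * x $ p j)"
      using BA i by simp
    also have "\<dots> = (\<Sum>j<?n. ?A $$ (p i, j) * x $ j)"
      by (rule sum.reindex_bij_betw[OF bij])
    also have "\<dots> = (?A *\<^sub>v x) $ p i"
      using A x(1) p[OF i] by (simp add: scalar_prod_def lessThan_atLeast0)
    also have "\<dots> = (k \<cdot>\<^sub>v y) $ i"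
      using x p[OF i] i by (simp add: y_def)
    finally show "(?B *\<^sub>v y) $ i = (k \<cdot>\<^sub>v y) $ i" .
  qed (use B in \<open>simp add: y_def\<close>)
  moreover have "y \<noteq> 0\<^sub>v ?n"
  proof
    assume y0: "y = 0\<^sub>v ?n"
    have "x $ i = 0" if i: "i < ?n" for i
    proof -
      obtain j where j: "j < ?n" "p j = i"
        using bij i by (metis bij_betw_imp_surj_on imageE lessThan_iff)
      then have "y $ j = x $ i" by (simp add: y_def)
      then show ?thesis using y0 j by simp
    qed
    then have "x = 0\<^sub>v ?n" using x(1) by (intro eq_vecI) auto
    with x(2) show False by simp
  qed
  ultimately show ?thesis
    using B unfolding eigenvalue_def eigenvector_def by (auto simp: y_def intro!: exI[of _ y])
qed

lemma eigenvalue_signless_laplacian: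
  assumes "distinct us" "distinct vs" "set us = set vs"
  shows "eigenvalue (signless_laplacian G us) k \<longleftrightarrow> eigenvalue (signless_laplacian G vs) k"
  using assms eigenvalue_signless_laplacian_imp by metis

lemma rho_Q_eq:
  assumes "finite (pverts G)" "distinct vs" "set vs = pverts G"
  shows "rho_Q G = Max (spectrum (signless_laplacian G vs))"
proof -
  have "eigenvalue (signless_laplacian G (vertex_list G)) = eigenvalue (signless_laplacian G vs)"
    using eigenvalue_signless_laplacian[OF vertex_list(1)[OF assms(1)] assms(2)]
      vertex_list(2)[OF assms(1)] assms(3) by auto
  then show ?thesis by (simp add: rho_Q_def spectrum_def)
qed

lemma pair_graphI:
  assumes "finite (pverts G)" "parcs G \<subseteq> pverts G \<times> pverts G" "sym (parcs G)" "irrefl (parcs G)"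
  shows "pair_graph G"
proof
  show "finite (parcs G)" using assms(1,2) by (meson finite_SigmaI finite_subset)
qed (use assms in \<open>auto simp: symmetric_def irrefl_def\<close>)

lemma pair_graph_complete_graph: "pair_graph (complete_graph n)"
  by (rule pair_graphI) (auto simp: complete_graph_def sym_def irrefl_def)

lemma pair_graph_cycle_graph:
  assumes "n \<ge> 3"
  shows "pair_graph (cycle_graph n)"
proof (rule pair_graphI)
  show "irrefl (parcs (cycle_graph n))"
    using assms by (auto simp: cycle_graph_def irrefl_def mod_Suc)
qed (auto simp: cycle_graph_def sym_def)

lemma pair_graph_copies:
  assumes "pair_graph G"
  shows "pair_graph (copies k G)"
proof -
  interpret pair_graph G by fact
  show ?thesis
    by (rule pair_graphI)
      (auto simp: copies_def sym_def irrefl_def arcs_symmetric pair_finite_verts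
        dest: in_arcsD1 in_arcsD2 no_loops')
qed

lemma pair_graph_graph_join:
  assumes "pair_graph G" "pair_graph H"
  shows "pair_graph (G \<nabla> H)"
proof -
  interpret G: pair_graph G by fact
  interpret H: pair_graph H by fact
  show ?thesis
    by (rule pair_graphI)
      (auto simp: graph_join_def sym_def irrefl_def G.pair_finite_verts H.pair_finite_verts
        dest: G.in_arcsD1 G.in_arcsD2 G.no_loops' H.in_arcsD1 H.in_arcsD2 H.no_loops'
        G.arcs_symmetric H.arcs_symmetric)
qed

end

theory Submission
  imports Defs
begin

text \<open>
  Write \<open>d v\<close> for the degree of \<open>v\<close> and \<open>N(v)\<close> for its neighbourhood. A cycle inside \<open>N(v)\<close>
  together with \<open>v\<close> is a wheel, so in a wheel-free graph every \<open>N(v)\<close> induces a forest and has at most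
  \<open>d v - 1\<close> edges (\<open>card_arcs_neighbourhood\<close>). Each neighbour of \<open>v\<close> is adjacent to \<open>v\<close> and to at most
  all of the \<open>n - 1 - d v\<close> vertices outside, so the degrees of the neighbours of \<open>v\<close> add up to at most
  \<open>2 (d v - 1) + d v + d v (n - 1 - d v) = d v (n + 2 - d v) - 2\<close>.

  Let \<open>r\<close> be the claimed bound, the larger root of \<open>r\<^sup>2 = (n + 2) r - 4\<close>, and test \<open>Q\<close> against the vector
  \<open>x v = d v - 2 / r\<close>. The quadratic terms in \<open>d v\<close> cancel, and the quadratic equation for \<open>r\<close> is exactly
  what makes the remaining linear inequality an identity: \<open>Q x\<close> exceeds \<open>r x\<close> at \<open>v\<close> by the degree sum
  minus its bound (\<open>edge_sum_weight\<close>). Hence \<open>Q x \<le> r x\<close> with \<open>x > 0\<close>, after an obvious change at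
  isolated vertices, and the maximum principle \<open>eigenvalue_le_of_positive_supersolution\<close> bounds every
  eigenvalue by \<open>r\<close>.

  If \<open>r\<close> is an eigenvalue, the maximum principle gives a nonempty set, closed under taking neighbours,
  on which the degree bound is attained: \<open>N(v)\<close> spans a tree and is completely joined to the vertices
  outside. The latter forces non-adjacent vertices to have equal neighbourhoods, so the graph is
  complete multipartite. The trees provide a triangle, and there is no \<open>K\<^sub>4\<close>, hence there are three
  parts; two parts with two vertices each would give a 4-cycle in the neighbourhood of a vertex of the
  third part, a wheel on five vertices. So two of the parts are single vertices, and the graph is
  \<open>K\<^sub>2 \<nabla> (n - 2) K\<^sub>1\<close> (\<open>hub_pair_of_extremal\<close>). Conversely that graph has a positive eigenvector for \<open>r\<close>,
  constant on the two hubs and on the other vertices, and again by the maximum principle \<open>r\<close> is its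
  largest eigenvalue.
\<close>

section \<open>Eigenfunctions of the signless Laplacian\<close>

definition nbrs :: "'a pair_pre_digraph \<Rightarrow> 'a \<Rightarrow> 'a set" where
  "nbrs G v = {u. (v, u) \<in> parcs G}"

text \<open>
  The value at \<open>v\<close> of the signless Laplacian applied to \<open>f\<close>, written as a sum over the edges at \<open>v\<close>:
  the degree on the diagonal contributes one copy of \<open>f v\<close> for every edge.
\<close>

definition edge_sum :: "'a pair_pre_digraph \<Rightarrow> ('a \<Rightarrow> real) \<Rightarrow> 'a \<Rightarrow> real" where
  "edge_sum G f v = (\<Sum>u\<in>nbrs G v. f v + f u)"

definition eigenfunction :: "'a pair_pre_digraph \<Rightarrow> real \<Rightarrow> ('a \<Rightarrow> real) \<Rightarrow> bool" where
  "eigenfunction G k f \<longleftrightarrow>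
     (\<exists>v\<in>pverts G. f v \<noteq> 0) \<and> (\<forall>v\<in>pverts G. edge_sum G f v = k * f v)"

context pair_graph begin

lemma nbrs_subset: "nbrs G v \<subseteq> pverts G"
  by (auto simp: nbrs_def dest: in_arcsD2)

lemma finite_nbrs [simp]: "finite (nbrs G v)"
  using nbrs_subset pair_finite_verts by (rule finite_subset)

lemma nbrs_sym: "u \<in> nbrs G v \<longleftrightarrow> v \<in> nbrs G u"
  using arcs_symmetric by (auto simp: nbrs_def)

lemma not_in_nbrs_self [simp]: "v \<notin> nbrs G v"
  using no_loops' by (auto simp: nbrs_def)

lemma out_degree_eq_card_nbrs: "out_degree (with_proj G) v = card (nbrs G v)"
proof -
  have "out_arcs (with_proj G) v = Pair v ` nbrs G v"
    by (auto simp: nbrs_def)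
  then show ?thesis by (simp add: out_degree_def card_image inj_on_def)
qed

lemma edge_sum_eq: "edge_sum G f v = real (card (nbrs G v)) * f v + (\<Sum>u\<in>nbrs G v. f u)"
  by (simp add: edge_sum_def sum.distrib)

lemma signless_laplacian_mult_vec:
  assumes vs: "distinct vs" "set vs = pverts G" and i: "i < length vs"
  shows "(signless_laplacian G vs *\<^sub>v vec (length vs) (\<lambda>j. f (vs ! j))) $ i = edge_sum G f (vs ! i)"
proof -
  let ?v = "vs ! i"
  have v: "?v \<in> pverts G" using i vs by auto
  have bij: "bij_betw ((!) vs) {..<length vs} (pverts G)"
    using vs by (metis bij_betw_nth)
  have "(signless_laplacian G vs *\<^sub>v vec (length vs) (\<lambda>j. f (vs ! j))) $ i
      = (\<Sum>j<length vs. signless_laplacian G vs $$ (i, j) * f (vs ! j))"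
    using i signless_laplacian_carrier[of G vs] by (simp add: scalar_prod_def lessThan_atLeast0)
  also have "\<dots> = (\<Sum>j<length vs. ((if ?v = vs ! j then real (card (nbrs G ?v)) else 0)
      + (if vs ! j \<in> nbrs G ?v then 1 else 0)) * f (vs ! j))"
    using i vs(1) by (intro sum.cong refl)
      (simp add: signless_laplacian_index out_degree_eq_card_nbrs nth_eq_iff_index_eq nbrs_def)
  also have "\<dots> = (\<Sum>u\<in>pverts G. ((if ?v = u then real (card (nbrs G ?v)) else 0)
      + (if u \<in> nbrs G ?v then 1 else 0)) * f u)"
    by (rule sum.reindex_bij_betw[OF bij])
  also have "\<dots> = (\<Sum>u\<in>pverts G. if ?v = u then real (card (nbrs G ?v)) * f u else 0)
      + (\<Sum>u\<in>pverts G. if u \<in> nbrs G ?v then f u else 0)"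
    by (subst sum.distrib[symmetric], intro sum.cong refl) (simp add: algebra_simps)
  also have "\<dots> = edge_sum G f ?v"
    unfolding edge_sum_eq using v nbrs_subset[of ?v] pair_finite_verts
    by (simp add: sum.inter_restrict[symmetric] Int_absorb1)
  finally show ?thesis .
qed

text \<open>
  Functions on the vertices replace vectors indexed by an enumeration, so that the graph arguments
  below never mention positions in a list.
\<close>

lemma spectrum_signless_laplacian:
  assumes vs: "distinct vs" "set vs = pverts G"
  shows "spectrum (signless_laplacian G vs) = {k. \<exists>f. eigenfunction G k f}"
proof -
  let ?Q = "signless_laplacian G vs" and ?n = "length vs"
  have dim: "dim_row ?Q = ?n" "dim_col ?Q = ?n" using signless_laplacian_carrier[of G vs] by auto
  have all: "(\<forall>v\<in>pverts G. P v) \<longleftrightarrow> (\<forall>i<?n. P (vs ! i))" for P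
    unfolding vs(2)[symmetric] by (metis in_set_conv_nth)
  have vec: "eigenvector ?Q (vec ?n (\<lambda>j. f (vs ! j))) k \<longleftrightarrow> eigenfunction G k f" for f k
  proof -
    have "vec ?n (\<lambda>j. f (vs ! j)) = 0\<^sub>v ?n \<longleftrightarrow> (\<forall>v\<in>pverts G. f v = 0)"
      unfolding all by (auto simp: vec_eq_iff)
    moreover have "?Q *\<^sub>v vec ?n (\<lambda>j. f (vs ! j)) = k \<cdot>\<^sub>v vec ?n (\<lambda>j. f (vs ! j))
        \<longleftrightarrow> (\<forall>v\<in>pverts G. edge_sum G f v = k * f v)"
      unfolding all using dim by (simp add: vec_eq_iff signless_laplacian_mult_vec[OF vs] del: index_mult_mat_vec)
    ultimately show ?thesis by (auto simp: eigenvector_def eigenfunction_def dim)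
  qed
  have ex: "\<exists>f. x = vec ?n (\<lambda>j. f (vs ! j))" if "x \<in> carrier_vec ?n" for x :: "real vec"
  proof -
    have "inj_on ((!) vs) {..<?n}" using vs(1) by (simp add: inj_on_nth)
    then show ?thesis
      using that by (intro exI[of _ "\<lambda>u. x $ inv_into {..<?n} ((!) vs) u"]) (auto simp: vec_eq_iff)
  qed
  have "eigenvalue ?Q k \<longleftrightarrow> (\<exists>f. eigenfunction G k f)" for k
  proof
    assume "eigenvalue ?Q k"
    then obtain x where x: "eigenvector ?Q x k" by (auto simp: eigenvalue_def)
    then have "x \<in> carrier_vec ?n" by (simp add: eigenvector_def dim)
    with x show "\<exists>f. eigenfunction G k f" using ex vec by metis
  next
    assume "\<exists>f. eigenfunction G k f"
    then show "eigenvalue ?Q k" using vec by (auto simp: eigenvalue_def)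
  qed
  then show ?thesis by (auto simp: spectrum_def)
qed

end

text \<open>
  Over the complex numbers an eigenvector \<open>z = x + i y\<close> exists. Comparing \<open>y \<bullet> A x\<close> with \<open>x \<bullet> A y\<close> shows
  that its eigenvalue is real, and then \<open>x\<close> or \<open>y\<close> is a real eigenvector.
\<close>

lemma symmetric_real_mat_eigenvalue_exists:
  fixes A :: "real mat"
  assumes A: "A \<in> carrier_mat n n" and n: "n > 0"
    and sym: "\<And>i j. i < n \<Longrightarrow> j < n \<Longrightarrow> A $$ (i, j) = A $$ (j, i)"
  shows "spectrum A \<noteq> {}"
proof -
  let ?B = "map_mat complex_of_real A"
  have B: "?B \<in> carrier_mat n n" using A by simp
  obtain k z where z: "eigenvector ?B z k"
    using spectrum_non_empty[OF B n] by (auto simp: spectrum_def eigenvalue_def)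
  then have zc: "z \<in> carrier_vec n" and z0: "z \<noteq> 0\<^sub>v n" and ev: "?B *\<^sub>v z = k \<cdot>\<^sub>v z"
    using A by (auto simp: eigenvector_def)
  define x where "x = vec n (\<lambda>i. Re (z $ i))"
  define y where "y = vec n (\<lambda>i. Im (z $ i))"
  have row: "(\<Sum>j<n. complex_of_real (A $$ (i, j)) * z $ j) = k * z $ i" if "i < n" for i
  proof -
    have "(?B *\<^sub>v z) $ i = (k \<cdot>\<^sub>v z) $ i" by (simp add: ev)
    then show ?thesis using that A zc by (simp add: scalar_prod_def lessThan_atLeast0)
  qed
  have Ax: "(\<Sum>j<n. A $$ (i, j) * x $ j) = Re k * x $ i - Im k * y $ i" if "i < n" for i
    using arg_cong[OF row[OF that], of Re] that by (simp add: x_def y_def)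
  have Ay: "(\<Sum>j<n. A $$ (i, j) * y $ j) = Re k * y $ i + Im k * x $ i" if "i < n" for i
    using arg_cong[OF row[OF that], of Im] that by (simp add: x_def y_def)
  have "(\<Sum>i<n. y $ i * (\<Sum>j<n. A $$ (i, j) * x $ j)) = (\<Sum>i<n. \<Sum>j<n. A $$ (i, j) * x $ j * y $ i)"
    by (simp add: sum_distrib_left algebra_simps)
  also have "\<dots> = (\<Sum>j<n. \<Sum>i<n. A $$ (j, i) * y $ i * x $ j)"
    by (subst sum.swap) (auto intro!: sum.cong simp: sym)
  also have "\<dots> = (\<Sum>j<n. x $ j * (\<Sum>i<n. A $$ (j, i) * y $ i))"
    by (simp add: sum_distrib_left algebra_simps)
  finally have "(\<Sum>i<n. y $ i * (Re k * x $ i - Im k * y $ i))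
      = (\<Sum>i<n. x $ i * (Re k * y $ i + Im k * x $ i))"
    by (simp add: Ax Ay)
  then have "(\<Sum>i<n. x $ i * (Re k * y $ i + Im k * x $ i) - y $ i * (Re k * x $ i - Im k * y $ i)) = 0"
    by (simp add: sum_subtractf)
  then have "Im k * (\<Sum>i<n. (x $ i)\<^sup>2 + (y $ i)\<^sup>2) = 0"
    by (simp add: sum_distrib_left algebra_simps power2_eq_square)
  moreover have "(\<Sum>i<n. (x $ i)\<^sup>2 + (y $ i)\<^sup>2) \<noteq> 0"
  proof
    assume "(\<Sum>i<n. (x $ i)\<^sup>2 + (y $ i)\<^sup>2) = 0"
    then have "\<forall>i<n. (x $ i)\<^sup>2 + (y $ i)\<^sup>2 = 0" by (subst (asm) sum_nonneg_eq_0_iff) auto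
    then have "z = 0\<^sub>v n" using zc
      by (intro eq_vecI) (auto simp: x_def y_def complex_eq_iff sum_power2_eq_zero_iff)
    with z0 show False by simp
  qed
  ultimately have im: "Im k = 0" by simp
  have real_vec: "eigenvector A w (Re k)"
    if "w \<in> carrier_vec n" "w \<noteq> 0\<^sub>v n"
      and "\<And>i. i < n \<Longrightarrow> (\<Sum>j<n. A $$ (i, j) * w $ j) = Re k * w $ i" for w
    using that A unfolding eigenvector_def
    by (auto intro!: eq_vecI simp: scalar_prod_def lessThan_atLeast0)
  have "x \<noteq> 0\<^sub>v n \<or> y \<noteq> 0\<^sub>v n"
    using z0 zc by (auto simp: vec_eq_iff x_def y_def complex_eq_iff)
  moreover have "x \<in> carrier_vec n" "y \<in> carrier_vec n" by (simp_all add: x_def y_def)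
  ultimately have "\<exists>w. eigenvector A w (Re k)"
    using real_vec[of x] real_vec[of y] Ax Ay im by auto
  then show ?thesis by (auto simp: spectrum_def eigenvalue_def)
qed

context pair_graph begin

text \<open>
  The spectrum of a real symmetric matrix is finite and not empty, so its maximum is attained.
\<close>

lemma rho_Q_spectrum:
  assumes "pverts G \<noteq> {}"
  shows "\<exists>f. eigenfunction G (rho_Q G) f"
    and "\<And>k f. eigenfunction G k f \<Longrightarrow> k \<le> rho_Q G"
proof -
  let ?Q = "signless_laplacian G (vertex_list G)" and ?n = "length (vertex_list G)"
  note vs = vertex_list[OF pair_finite_verts]
  have "?n > 0" using vs(2) assms by auto
  moreover have "?Q $$ (i, j) = ?Q $$ (j, i)" if "i < ?n" "j < ?n" for i j
    using that arcs_symmetric by (auto simp: signless_laplacian_index)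
  ultimately have "spectrum ?Q \<noteq> {}"
    by (intro symmetric_real_mat_eigenvalue_exists[OF signless_laplacian_carrier])
  moreover have fin: "finite (spectrum ?Q)"
    by (rule card_finite_spectrum[OF signless_laplacian_carrier])
  ultimately have "rho_Q G \<in> spectrum ?Q" unfolding rho_Q_def by (rule Max_in[rotated])
  then show "\<exists>f. eigenfunction G (rho_Q G) f"
    by (simp add: spectrum_signless_laplacian[OF vs])
  show "k \<le> rho_Q G" if "eigenfunction G k f" for k f
    unfolding rho_Q_def using fin that
    by (intro Max_ge) (auto simp: spectrum_signless_laplacian[OF vs])
qed

text \<open>
  A maximum principle. At a vertex where \<open>\<bar>f\<bar> / x\<close> takes its maximum \<open>m\<close>, the eigenvalue equation gives
  \<open>\<bar>k\<bar> m x \<le> Q \<bar>f\<bar> \<le> m Q x \<le> r m x\<close>. If \<open>k = r\<close>, the whole chain consists of equalities, so every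
  neighbour attains the maximum as well; the set \<open>S\<close> consists of the vertices that do.
\<close>

lemma eigenvalue_le_of_positive_supersolution:
  assumes x: "\<And>v. v \<in> pverts G \<Longrightarrow> x v > 0"
    and sup: "\<And>v. v \<in> pverts G \<Longrightarrow> edge_sum G x v \<le> r * x v"
    and f: "eigenfunction G k f"
  shows "k \<le> r"
    and "k = r \<Longrightarrow> \<exists>S\<subseteq>pverts G. S \<noteq> {} \<and> (\<forall>v\<in>S. edge_sum G x v = r * x v \<and> nbrs G v \<subseteq> S)"
proof -
  define m where "m = Max ((\<lambda>v. \<bar>f v\<bar> / x v) ` pverts G)"
  define S where "S = {v\<in>pverts G. \<bar>f v\<bar> = m * x v}"
  obtain v0 where v0: "v0 \<in> pverts G" "f v0 \<noteq> 0" using f by (auto simp: eigenfunction_def)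
  have le: "\<bar>f v\<bar> \<le> m * x v" if "v \<in> pverts G" for v
  proof -
    have "\<bar>f v\<bar> / x v \<le> m" unfolding m_def using that pair_finite_verts by (intro Max_ge) auto
    then show ?thesis using x[OF that] by (simp add: field_simps)
  qed
  have m: "m > 0"
    using le[OF v0(1)] v0(2) x[OF v0(1)] by (smt (verit) zero_less_mult_pos2 zero_less_abs_iff)
  have "m \<in> (\<lambda>v. \<bar>f v\<bar> / x v) ` pverts G"
    unfolding m_def using v0 pair_finite_verts by (intro Max_in) auto
  then obtain v1 where v1: "v1 \<in> S" using x by (force simp: S_def)
  have chain: "m * (\<bar>k\<bar> * x v) = \<bar>edge_sum G f v\<bar>"
      "\<bar>edge_sum G f v\<bar> \<le> edge_sum G (\<lambda>u. \<bar>f u\<bar>) v"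
      "edge_sum G (\<lambda>u. \<bar>f u\<bar>) v \<le> m * edge_sum G x v"
      "m * edge_sum G x v \<le> m * (r * x v)" if "v \<in> S" for v
  proof -
    have v: "v \<in> pverts G" "\<bar>f v\<bar> = m * x v" using that by (auto simp: S_def)
    have "\<bar>edge_sum G f v\<bar> = \<bar>k\<bar> * \<bar>f v\<bar>"
      using v f by (simp add: eigenfunction_def abs_mult)
    then show "m * (\<bar>k\<bar> * x v) = \<bar>edge_sum G f v\<bar>" using v by simp
    show "\<bar>edge_sum G f v\<bar> \<le> edge_sum G (\<lambda>u. \<bar>f u\<bar>) v"
      unfolding edge_sum_def by (rule order_trans[OF sum_abs]) (intro sum_mono abs_triangle_ineq)
    show "edge_sum G (\<lambda>u. \<bar>f u\<bar>) v \<le> m * edge_sum G x v"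
      unfolding edge_sum_def sum_distrib_left distrib_left
      using v nbrs_subset by (intro sum_mono add_mono le) auto
    show "m * edge_sum G x v \<le> m * (r * x v)"
      using m sup[OF v(1)] by simp
  qed
  have "m * (\<bar>k\<bar> * x v1) \<le> m * (r * x v1)" using chain[OF v1] by linarith
  moreover have "x v1 > 0" using v1 x by (simp add: S_def)
  ultimately have abs_le: "\<bar>k\<bar> \<le> r" using m by simp
  then show "k \<le> r" by simp
  show "\<exists>S\<subseteq>pverts G. S \<noteq> {} \<and> (\<forall>v\<in>S. edge_sum G x v = r * x v \<and> nbrs G v \<subseteq> S)" if "k = r"
  proof (intro exI[of _ S] conjI ballI)
    show "S \<subseteq> pverts G" "S \<noteq> {}" using v1 by (auto simp: S_def)
    fix v assume v: "v \<in> S"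
    have "\<bar>k\<bar> = r" using abs_le that by simp
    then have eq: "m * edge_sum G x v = m * (r * x v)"
        "edge_sum G (\<lambda>u. \<bar>f u\<bar>) v = m * edge_sum G x v"
      using chain[OF v] by auto
    then show "edge_sum G x v = r * x v" using m by simp
    have "(\<Sum>u\<in>nbrs G v. (m * x v + m * x u) - (\<bar>f v\<bar> + \<bar>f u\<bar>)) = 0"
      using eq(2) by (simp add: edge_sum_def sum_subtractf sum_distrib_left distrib_left)
    then have "\<forall>u\<in>nbrs G v. (m * x v + m * x u) - (\<bar>f v\<bar> + \<bar>f u\<bar>) = 0"
      using le v nbrs_subset by (subst (asm) sum_nonneg_eq_0_iff) (auto simp: S_def)
    then show "nbrs G v \<subseteq> S" using v nbrs_subset by (auto simp: S_def)
  qed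
qed
end

section \<open>Graphs without cycles have few edges\<close>

text \<open>
  Take a longest path. All neighbours of its first vertex lie on it, and one of them is at distance at
  least 2 along the path; the edge back to the first vertex closes a cycle.
\<close>

lemma cycle_of_min_degree_two:
  assumes fin: "finite A" "A \<noteq> {}" and E: "sym E" "irrefl E"
    and deg: "\<And>x. x \<in> A \<Longrightarrow> \<exists>y\<in>A. \<exists>z\<in>A. y \<noteq> z \<and> (x, y) \<in> E \<and> (x, z) \<in> E"
  obtains cs where "distinct cs" "length cs \<ge> 3" "set cs \<subseteq> A"
    "\<And>i. i < length cs \<Longrightarrow> (cs ! i, cs ! (Suc i mod length cs)) \<in> E"
proof -
  define path where "path p \<longleftrightarrow> distinct p \<and> set p \<subseteq> A \<and> p \<noteq> []
    \<and> (\<forall>i. Suc i < length p \<longrightarrow> (p ! i, p ! Suc i) \<in> E)" for p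
  obtain x0 where "x0 \<in> A" using fin by auto
  then have "path [x0]" by (simp add: path_def)
  moreover have "\<forall>p. path p \<longrightarrow> length p \<le> card A"
    unfolding path_def using fin(1) by (metis card_mono distinct_card)
  then have "\<forall>p. path p \<longrightarrow> length p < Suc (card A)" by (simp add: less_Suc_eq_le)
  ultimately obtain p where p: "path p" and max: "\<And>q. path q \<Longrightarrow> length q \<le> length p"
    using ex_has_greatest_nat[of path "[x0]" length "Suc (card A)"] by auto
  have len: "0 < length p" using p by (simp add: path_def)
  \<comment> \<open>A neighbour of the first vertex outside the path would extend it.\<close>
  have end_nbr: "y \<in> set p" if "y \<in> A" "(p ! 0, y) \<in> E" for y
  proof (rule ccontr)
    assume "y \<notin> set p"
    moreover have "(y, p ! 0) \<in> E" using that E(1) by (auto dest: symD)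
    ultimately have "path (y # p)"
      using p that(1) by (auto simp: path_def nth_Cons split: nat.splits)
    then show False using max by fastforce
  qed
  have "p ! 0 \<in> A" using p len by (auto simp: path_def)
  then obtain y z where "y \<in> A" "z \<in> A" "y \<noteq> z" "(p ! 0, y) \<in> E" "(p ! 0, z) \<in> E"
    using deg by blast
  moreover from this obtain i j where "i < length p" "p ! i = y" "j < length p" "p ! j = z"
    using end_nbr by (metis in_set_conv_nth)
  ultimately have "i \<noteq> j" "(p ! 0, p ! i) \<in> E" "(p ! 0, p ! j) \<in> E" "i \<noteq> 0" "j \<noteq> 0"
      "i < length p" "j < length p"
    using E(2) by (auto simp: irrefl_def intro: gr0I)
  moreover from this have "i \<ge> 2 \<or> j \<ge> 2" by linarith
  ultimately obtain k where k: "k \<ge> 2" "k < length p" "(p ! 0, p ! k) \<in> E" by blast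
  let ?cs = "take (Suc k) p"
  show thesis
  proof
    show "distinct ?cs" "set ?cs \<subseteq> A" "length ?cs \<ge> 3"
      using p k set_take_subset[of "Suc k" p] by (auto simp: path_def)
    fix i assume "i < length ?cs"
    then have "i < k \<or> i = k" using k by auto
    moreover have "length ?cs = Suc k" using k by simp
    ultimately show "(?cs ! i, ?cs ! (Suc i mod length ?cs)) \<in> E"
      using k p E(1) by (auto simp: path_def simp del: length_take dest: symD)
  qed
qed

text \<open>
  A forest on \<open>m\<close> vertices has at most \<open>m - 1\<close> edges, each of which counts for two arcs: a vertex of degree
  at most one can be removed.
\<close>

lemma card_arcs_le_of_acyclic:
  assumes fin: "finite A" "A \<noteq> {}" and E: "sym E" "irrefl E"
    and acyclic: "\<And>cs. distinct cs \<Longrightarrow> length cs \<ge> 3 \<Longrightarrow> set cs \<subseteq> A \<Longrightarrow>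
      \<exists>i<length cs. (cs ! i, cs ! (Suc i mod length cs)) \<notin> E"
  shows "card (E \<inter> A \<times> A) \<le> 2 * (card A - 1)"
  using fin acyclic
proof (induction A rule: finite_psubset_induct)
  case (psubset A)
  obtain x where x: "x \<in> A" "\<And>y z. y \<in> A \<Longrightarrow> z \<in> A \<Longrightarrow> (x, y) \<in> E \<Longrightarrow> (x, z) \<in> E \<Longrightarrow> y = z"
    using cycle_of_min_degree_two[OF psubset.hyps psubset.prems(1) E] psubset.prems(2)
    by (metis linorder_not_le)
  define N where "N = {y\<in>A. (x, y) \<in> E}"
  define B where "B = A - {x}"
  have finB: "finite B" "finite N" using psubset.hyps by (auto simp: B_def N_def)
  have cA: "card A = Suc (card B)" unfolding B_def using psubset.hyps x(1) by (metis card_Suc_Diff1)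
  show ?case
  proof (cases "B = {}")
    case True
    then have "A = {x}" using x(1) by (auto simp: B_def)
    then have "E \<inter> A \<times> A = {}" using E(2) by (auto simp: irrefl_def)
    then show ?thesis by simp
  next
    case False
    have IH: "card (E \<inter> B \<times> B) \<le> 2 * (card B - 1)"
    proof (rule psubset.IH)
      show "B \<subset> A" "B \<noteq> {}" using x(1) False by (auto simp: B_def)
      show "\<exists>i<length cs. (cs ! i, cs ! (Suc i mod length cs)) \<notin> E"
        if "distinct cs" "length cs \<ge> 3" "set cs \<subseteq> B" for cs
        using that psubset.prems(2)[of cs] by (auto simp: B_def)
    qed
    have "card N \<le> 1" using x(2) finB by (auto simp: N_def card_le_Suc0_iff_eq)
    have "E \<inter> A \<times> A \<subseteq> (E \<inter> B \<times> B) \<union> ({x} \<times> N \<union> N \<times> {x})"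
      using E by (auto simp: N_def B_def dest: symD)
    then have "card (E \<inter> A \<times> A) \<le> card ((E \<inter> B \<times> B) \<union> ({x} \<times> N \<union> N \<times> {x}))"
      using finB by (intro card_mono) auto
    also have "\<dots> \<le> card (E \<inter> B \<times> B) + (card ({x} \<times> N) + card (N \<times> {x}))"
      by (meson add_left_mono card_Un_le order_trans)
    also have "\<dots> \<le> 2 * (card B - 1) + 2" using IH \<open>card N \<le> 1\<close> by (simp add: card_cartesian_product)
    also have "\<dots> = 2 * (card A - 1)"
    proof -
      have "card B > 0" using False finB by (simp add: card_gt_0_iff)
      then show ?thesis using cA by simp
    qed
    finally show ?thesis .
  qed
qed

section \<open>Isomorphisms and subgraphs\<close>

lemma graph_iso_iff:
  assumes G: "pair_wf_digraph G" and H: "pair_wf_digraph H"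
  shows "graph_iso G H \<longleftrightarrow> (\<exists>g. bij_betw g (pverts G) (pverts H)
    \<and> (\<forall>u\<in>pverts G. \<forall>v\<in>pverts G. (u, v) \<in> parcs G \<longleftrightarrow> (g u, g v) \<in> parcs H))"
proof
  assume "graph_iso G H"
  then obtain h where h: "pre_digraph.digraph_isomorphism (with_proj G) h"
      and H_eq: "with_proj H = app_iso h (with_proj G)"
    by (auto simp: graph_iso_def digraph_iso_def)
  let ?g = "iso_verts h"
  have inj: "inj_on ?g (pverts G)"
    and ends: "\<And>a. a \<in> parcs G \<Longrightarrow> ?g (fst a) = iso_tail h (iso_arcs h a)
      \<and> ?g (snd a) = iso_head h (iso_arcs h a)"
    using h by (auto simp: pre_digraph.digraph_isomorphism_def)
  have vH: "pverts H = ?g ` pverts G" and aH: "parcs H = iso_arcs h ` parcs G"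
      and "iso_tail h = fst" "iso_head h = snd"
    using H_eq by (auto simp: with_proj_def app_iso_def)
  then have "iso_arcs h (u, v) = (?g u, ?g v)" if "(u, v) \<in> parcs G" for u v
    using ends[OF that] by (simp add: prod_eq_iff)
  then have arcs: "parcs H = map_prod ?g ?g ` parcs G" unfolding aH by (intro image_cong) auto
  have iff: "(u, v) \<in> parcs G \<longleftrightarrow> (?g u, ?g v) \<in> parcs H" if "u \<in> pverts G" "v \<in> pverts G" for u v
  proof
    assume "(?g u, ?g v) \<in> parcs H"
    then obtain x y where xy: "(x, y) \<in> parcs G" "?g u = ?g x" "?g v = ?g y"
      using arcs by auto
    then have "x \<in> pverts G" "y \<in> pverts G"
      using pair_wf_digraph.in_arcsD1[OF G] pair_wf_digraph.in_arcsD2[OF G] by auto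
    then show "(u, v) \<in> parcs G" using xy that inj by (metis inj_onD)
  next
    assume "(u, v) \<in> parcs G"
    then show "(?g u, ?g v) \<in> parcs H" using arcs by force
  qed
  show "\<exists>g. bij_betw g (pverts G) (pverts H)
      \<and> (\<forall>u\<in>pverts G. \<forall>v\<in>pverts G. (u, v) \<in> parcs G \<longleftrightarrow> (g u, g v) \<in> parcs H)"
    using inj vH iff by (intro exI[of _ ?g]) (simp add: bij_betw_def)
next
  assume "\<exists>g. bij_betw g (pverts G) (pverts H)
      \<and> (\<forall>u\<in>pverts G. \<forall>v\<in>pverts G. (u, v) \<in> parcs G \<longleftrightarrow> (g u, g v) \<in> parcs H)"
  then obtain g where g: "inj_on g (pverts G)" "g ` pverts G = pverts H"
      and arcs: "\<And>u v. u \<in> pverts G \<Longrightarrow> v \<in> pverts G \<Longrightarrow> (u, v) \<in> parcs G \<longleftrightarrow> (g u, g v) \<in> parcs H"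
    by (auto simp: bij_betw_def)
  have sub: "parcs G \<subseteq> pverts G \<times> pverts G"
    using pair_wf_digraph.in_arcsD1[OF G] pair_wf_digraph.in_arcsD2[OF G] by auto
  have "inj_on (map_prod g g) (parcs G)"
    using map_prod_inj_on[OF g(1) g(1)] sub by (rule inj_on_subset)
  moreover have "parcs H = map_prod g g ` parcs G"
  proof
    show "parcs H \<subseteq> map_prod g g ` parcs G"
    proof
      fix e assume e: "e \<in> parcs H"
      then have "fst e \<in> g ` pverts G" "snd e \<in> g ` pverts G"
        using g(2) pair_wf_digraph.arc_fst_in_verts[OF H] pair_wf_digraph.arc_snd_in_verts[OF H] by auto
      then obtain u v where "u \<in> pverts G" "v \<in> pverts G" "e = (g u, g v)" by (metis imageE prod.collapse)
      then show "e \<in> map_prod g g ` parcs G" using e arcs by force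
    qed
    show "map_prod g g ` parcs G \<subseteq> parcs H" using arcs sub by auto
  qed
  ultimately show "graph_iso G H"
    unfolding graph_iso_def digraph_iso_def
    using g G by (intro exI[of _ "\<lparr>iso_verts = g, iso_arcs = map_prod g g, iso_head = snd, iso_tail = fst\<rparr>"])
      (auto simp: pre_digraph.digraph_isomorphism_def with_proj_def app_iso_def wf_digraph_wp_iff[unfolded with_proj_def])
qed

text \<open>
  An injective homomorphism embeds \<open>F\<close> into \<open>G\<close>, its image being the subgraph isomorphic to \<open>F\<close>.
\<close>

lemma contains_graphI:
  assumes G: "pair_wf_digraph G" and F: "pair_wf_digraph F"
    and f: "inj_on f (pverts F)" "f ` pverts F \<subseteq> pverts G"
    and arcs: "\<And>u v. (u, v) \<in> parcs F \<Longrightarrow> (f u, f v) \<in> parcs G"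
  shows "contains_graph G F"
proof -
  define H where "H = \<lparr>pverts = f ` pverts F, parcs = map_prod f f ` parcs F\<rparr>"
  have H: "pair_wf_digraph H"
    using pair_wf_digraph.in_arcsD1[OF F] pair_wf_digraph.in_arcsD2[OF F]
    by (auto simp: pair_wf_digraph_def H_def)
  have "subgraph (with_proj H) (with_proj G)"
    using f arcs G H by (auto simp: subgraph_def H_def wf_digraph_wp_iff)
  moreover have "graph_iso H F"
    unfolding graph_iso_iff[OF H F]
  proof (intro exI[of _ "inv_into (pverts F) f"] conjI ballI)
    show "bij_betw (inv_into (pverts F) f) (pverts H) (pverts F)"
      using f(1) by (auto simp: H_def intro: bij_betw_inv_into inj_on_imp_bij_betw)
    fix u v assume "u \<in> pverts H" "v \<in> pverts H"
    then obtain x y where xy: "x \<in> pverts F" "y \<in> pverts F" "u = f x" "v = f y"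
      by (auto simp: H_def)
    have "(f x, f y) \<in> map_prod f f ` parcs F \<longleftrightarrow> (x, y) \<in> parcs F"
    proof
      assume "(f x, f y) \<in> map_prod f f ` parcs F"
      then obtain x' y' where "(x', y') \<in> parcs F" "f x = f x'" "f y = f y'" by auto
      moreover from this have "x' \<in> pverts F" "y' \<in> pverts F"
        using pair_wf_digraph.in_arcsD1[OF F] pair_wf_digraph.in_arcsD2[OF F] by auto
      ultimately show "(x, y) \<in> parcs F" using xy f(1) by (metis inj_onD)
    qed force
    then show "(u, v) \<in> parcs H \<longleftrightarrow> (inv_into (pverts F) f u, inv_into (pverts F) f v) \<in> parcs F"
      using xy f(1) by (simp add: H_def)
  qed
  ultimately show ?thesis by (auto simp: contains_graph_def)
qed

section \<open>Neighbourhoods in wheel-free graphs\<close>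

lemma pair_graph_wheel: "l \<ge> 4 \<Longrightarrow> pair_graph (wheel l)"
  by (simp add: wheel_def pair_graph_graph_join pair_graph_complete_graph pair_graph_cycle_graph)

context pair_graph begin

lemma wf_pair: "pair_wf_digraph G" by unfold_locales

lemma contains_wheel:
  assumes v: "v \<in> pverts G" and cs: "distinct cs" "length cs \<ge> 3" "set cs \<subseteq> nbrs G v"
    and cyc: "\<And>i. i < length cs \<Longrightarrow> (cs ! i, cs ! (Suc i mod length cs)) \<in> parcs G"
  shows "contains_graph G (wheel (Suc (length cs)))"
proof (rule contains_graphI[where f = "case_sum (\<lambda>_. v) ((!) cs)"])
  let ?f = "case_sum (\<lambda>_. v) ((!) cs)"
  show "pair_wf_digraph G" by (rule wf_pair)
  show "pair_wf_digraph (wheel (Suc (length cs)))"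
    using cs by (intro pair_graph.wf_pair pair_graph_wheel) auto
  have rim: "cs ! i \<in> nbrs G v" "cs ! i \<noteq> v" if "i < length cs" for i
    using nth_mem[OF that] cs(3) not_in_nbrs_self[of v] by auto
  have verts: "pverts (wheel (Suc (length cs))) = Inl ` {0} \<union> Inr ` {..<length cs}"
    by (auto simp: wheel_def graph_join_def complete_graph_def cycle_graph_def)
  show "inj_on ?f (pverts (wheel (Suc (length cs))))"
    unfolding verts using rim(2) rim(2)[symmetric] cs(1) by (auto simp: inj_on_def nth_eq_iff_index_eq)
  show "?f ` pverts (wheel (Suc (length cs))) \<subseteq> pverts G"
    unfolding verts using rim(1) nbrs_subset v by fastforce
  fix x y assume "(x, y) \<in> parcs (wheel (Suc (length cs)))"
  then consider i j where "x = Inr i" "y = Inr j" "i < length cs" "j < length cs"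
      "j = Suc i mod length cs \<or> i = Suc j mod length cs"
    | i where "x = Inl 0" "y = Inr i" "i < length cs"
    | i where "x = Inr i" "y = Inl 0" "i < length cs"
    by (auto simp: wheel_def graph_join_def complete_graph_def cycle_graph_def)
  then show "(?f x, ?f y) \<in> parcs G"
    using cyc rim(1) arcs_symmetric by cases (auto simp: nbrs_def)
qed

lemma neighbourhood_acyclic:
  assumes "wheel_free G" "v \<in> pverts G" "distinct cs" "length cs \<ge> 3" "set cs \<subseteq> nbrs G v"
  shows "\<exists>i<length cs. (cs ! i, cs ! (Suc i mod length cs)) \<notin> parcs G"
  using contains_wheel[OF assms(2-5)] assms(1,4) by (auto simp: wheel_free_def)

lemma no_K4:
  assumes "wheel_free G" "b \<in> nbrs G a" "c \<in> nbrs G a" "d \<in> nbrs G a" "c \<in> nbrs G b" "d \<in> nbrs G b"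
  shows "d \<notin> nbrs G c"
proof
  assume d: "d \<in> nbrs G c"
  have "a \<in> pverts G" using assms(2) nbrs_subset nbrs_sym by blast
  moreover have "distinct [b, c, d]" using assms d by auto
  moreover have "(b, c) \<in> parcs G" "(c, d) \<in> parcs G" "(d, b) \<in> parcs G"
    using assms d nbrs_sym by (auto simp: nbrs_def)
  then have "\<forall>i<length [b, c, d]. ([b, c, d] ! i, [b, c, d] ! (Suc i mod length [b, c, d])) \<in> parcs G"
    by (simp add: All_less_Suc)
  ultimately show False
    using neighbourhood_acyclic[OF assms(1), of a "[b, c, d]"] assms(2-4) by force
qed

lemma no_W5:
  assumes "wheel_free G" "{b, c, d, e} \<subseteq> nbrs G a" "b \<noteq> d" "c \<noteq> e"
    and "c \<in> nbrs G b" "d \<in> nbrs G c" "e \<in> nbrs G d"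
  shows "b \<notin> nbrs G e"
proof
  assume b: "b \<in> nbrs G e"
  have "a \<in> pverts G" using assms(2) nbrs_subset nbrs_sym by blast
  moreover have "distinct [b, c, d, e]" using assms b by auto
  moreover have "(b, c) \<in> parcs G" "(c, d) \<in> parcs G" "(d, e) \<in> parcs G" "(e, b) \<in> parcs G"
    using assms b by (auto simp: nbrs_def)
  then have "\<forall>i<length [b, c, d, e].
      ([b, c, d, e] ! i, [b, c, d, e] ! (Suc i mod length [b, c, d, e])) \<in> parcs G"
    by (simp add: All_less_Suc)
  ultimately show False
    using neighbourhood_acyclic[OF assms(1), of a "[b, c, d, e]"] assms(2) by force
qed

lemma card_arcs_neighbourhood:
  assumes "wheel_free G" "v \<in> pverts G" "nbrs G v \<noteq> {}"
  shows "card (parcs G \<inter> nbrs G v \<times> nbrs G v) \<le> 2 * (card (nbrs G v) - 1)"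
proof (rule card_arcs_le_of_acyclic)
  show "sym (parcs G)" "irrefl (parcs G)" using arcs_symmetric no_loops' by (auto simp: sym_def irrefl_def)
qed (use assms neighbourhood_acyclic in auto)

abbreviation non_nbrs :: "'a \<Rightarrow> 'a set" where
  "non_nbrs v \<equiv> pverts G - insert v (nbrs G v)"

lemma card_non_nbrs:
  assumes "v \<in> pverts G"
  shows "card (non_nbrs v) + card (nbrs G v) + 1 = card (pverts G)"
proof -
  have "card (insert v (nbrs G v)) = card (nbrs G v) + 1" by simp
  moreover have "insert v (nbrs G v) \<subseteq> pverts G" using assms nbrs_subset by auto
  ultimately show ?thesis
    using card_Diff_subset[of "insert v (nbrs G v)" "pverts G"] card_mono[OF pair_finite_verts, of "insert v (nbrs G v)"]
    by simp
qed

text \<open>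
  The neighbours of \<open>u \<in> N(v)\<close> are \<open>v\<close> itself, vertices of \<open>N(v)\<close>, and vertices outside.
\<close>

lemma sum_degrees_neighbourhood:
  assumes v: "v \<in> pverts G"
  shows "(\<Sum>u\<in>nbrs G v. card (nbrs G u)) = card (parcs G \<inter> nbrs G v \<times> nbrs G v)
    + card (nbrs G v) + (\<Sum>u\<in>nbrs G v. card (nbrs G u \<inter> non_nbrs v))"
proof -
  have "card (nbrs G u) = card (nbrs G u \<inter> nbrs G v) + 1 + card (nbrs G u \<inter> non_nbrs v)"
    if "u \<in> nbrs G v" for u
  proof -
    have "nbrs G u = insert v (nbrs G u \<inter> nbrs G v) \<union> (nbrs G u \<inter> non_nbrs v)"
      using nbrs_subset[of u] nbrs_sym that by auto
    then have "card (nbrs G u) = card (insert v (nbrs G u \<inter> nbrs G v)) + card (nbrs G u \<inter> non_nbrs v)"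
      by (subst card_Un_disjoint[symmetric]) auto
    then show ?thesis by simp
  qed
  then have "(\<Sum>u\<in>nbrs G v. card (nbrs G u))
      = (\<Sum>u\<in>nbrs G v. card (nbrs G u \<inter> nbrs G v)) + card (nbrs G v)
        + (\<Sum>u\<in>nbrs G v. card (nbrs G u \<inter> non_nbrs v))"
    using sum.distrib[of "\<lambda>u. card (nbrs G u \<inter> nbrs G v) + 1" "\<lambda>u. card (nbrs G u \<inter> non_nbrs v)" "nbrs G v"]
      sum.distrib[of "\<lambda>u. card (nbrs G u \<inter> nbrs G v)" "\<lambda>u. 1" "nbrs G v"]
    by simp
  moreover have "parcs G \<inter> nbrs G v \<times> nbrs G v = (SIGMA u:nbrs G v. nbrs G u \<inter> nbrs G v)"
    by (auto simp: nbrs_def)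
  ultimately show ?thesis by simp
qed

lemma sum_degrees_neighbourhood_le:
  assumes "wheel_free G" and v: "v \<in> pverts G" and "nbrs G v \<noteq> {}"
  shows "(\<Sum>u\<in>nbrs G v. card (nbrs G u))
      \<le> 2 * (card (nbrs G v) - 1) + card (nbrs G v) + card (nbrs G v) * card (non_nbrs v)"
    and "(\<Sum>u\<in>nbrs G v. card (nbrs G u))
        = 2 * (card (nbrs G v) - 1) + card (nbrs G v) + card (nbrs G v) * card (non_nbrs v) \<Longrightarrow>
      card (parcs G \<inter> nbrs G v \<times> nbrs G v) = 2 * (card (nbrs G v) - 1)
      \<and> (\<forall>u\<in>nbrs G v. non_nbrs v \<subseteq> nbrs G u)"
proof -
  note split = sum_degrees_neighbourhood[OF v] and tree = card_arcs_neighbourhood[OF assms]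
  have le: "card (nbrs G u \<inter> non_nbrs v) \<le> card (non_nbrs v)" for u
    using pair_finite_verts by (intro card_mono) auto
  then have sum_le: "(\<Sum>u\<in>nbrs G v. card (nbrs G u \<inter> non_nbrs v)) \<le> card (nbrs G v) * card (non_nbrs v)"
    using sum_bounded_above[of "nbrs G v" "\<lambda>u. card (nbrs G u \<inter> non_nbrs v)" "card (non_nbrs v)"] by simp
  with split tree show "(\<Sum>u\<in>nbrs G v. card (nbrs G u))
      \<le> 2 * (card (nbrs G v) - 1) + card (nbrs G v) + card (nbrs G v) * card (non_nbrs v)" by linarith
  assume eq: "(\<Sum>u\<in>nbrs G v. card (nbrs G u))
        = 2 * (card (nbrs G v) - 1) + card (nbrs G v) + card (nbrs G v) * card (non_nbrs v)"
  have "(\<Sum>u\<in>nbrs G v. card (nbrs G u \<inter> non_nbrs v)) = (\<Sum>u\<in>nbrs G v. card (non_nbrs v))"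
    using eq split tree sum_le by simp
  then have "card (nbrs G u \<inter> non_nbrs v) = card (non_nbrs v)" if "u \<in> nbrs G v" for u
    by (rule sum_mono_inv[OF _ le that finite_nbrs])
  then have "nbrs G u \<inter> non_nbrs v = non_nbrs v" if "u \<in> nbrs G v" for u
    using that pair_finite_verts by (intro card_subset_eq) auto
  then show "card (parcs G \<inter> nbrs G v \<times> nbrs G v) = 2 * (card (nbrs G v) - 1)
      \<and> (\<forall>u\<in>nbrs G v. non_nbrs v \<subseteq> nbrs G u)"
    using eq split tree sum_le by auto
qed

end

section \<open>The extremal graph\<close>

text \<open>
  The graph \<open>K\<^sub>2 \<nabla> m K\<^sub>1\<close> with an unspecified vertex set: \<open>a\<close> and \<open>b\<close> are the vertices of \<open>K\<^sub>2\<close>.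
\<close>

definition hub_pair :: "'a pair_pre_digraph \<Rightarrow> 'a \<Rightarrow> 'a \<Rightarrow> bool" where
  "hub_pair G a b \<longleftrightarrow> a \<in> pverts G \<and> b \<in> pverts G \<and> a \<noteq> b \<and>
     parcs G = {(x, y). x \<in> pverts G \<and> y \<in> pverts G \<and> x \<noteq> y \<and> (x \<in> {a, b} \<or> y \<in> {a, b})}"

text \<open>
  An edge avoiding two adjacent vertices that dominate the graph would complete them to a \<open>K\<^sub>4\<close>.
\<close>

lemma (in pair_graph) hub_pairI:
  assumes wf: "wheel_free G" and ab: "b \<in> nbrs G a"
    and a: "pverts G \<subseteq> insert a (nbrs G a)" and b: "pverts G \<subseteq> insert b (nbrs G b)"
  shows "hub_pair G a b"
proof -
  have "x \<in> {a, b} \<or> y \<in> {a, b}" if xy: "(x, y) \<in> parcs G" for x y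
  proof (rule ccontr)
    assume "\<not> ?thesis"
    then have "x \<in> nbrs G a" "y \<in> nbrs G a" "x \<in> nbrs G b" "y \<in> nbrs G b"
      using in_arcsD1[OF xy] in_arcsD2[OF xy] a b by auto
    then have "y \<notin> nbrs G x" by (rule no_K4[OF wf ab])
    with xy show False by (simp add: nbrs_def)
  qed
  moreover have "(x, y) \<in> parcs G"
    if "x \<in> pverts G" "y \<in> pverts G" "x \<noteq> y" "x \<in> {a, b} \<or> y \<in> {a, b}" for x y
    using that a b arcs_symmetric by (auto simp: nbrs_def)
  ultimately have "parcs G = {(x, y). x \<in> pverts G \<and> y \<in> pverts G \<and> x \<noteq> y \<and> (x \<in> {a, b} \<or> y \<in> {a, b})}"
    by (auto dest: in_arcsD1 in_arcsD2 no_loops')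
  moreover have "a \<in> pverts G" "b \<in> pverts G" "a \<noteq> b" using ab nbrs_subset nbrs_sym by auto
  ultimately show ?thesis by (simp add: hub_pair_def)
qed

text \<open>
  The hypothesis \<open>join\<close> makes non-adjacent vertices twins, so \<open>G\<close> is complete multipartite. By the
  hypothesis \<open>tree\<close> some neighbourhood contains an edge, so there is a triangle and at least three parts.
\<close>

lemma (in pair_graph) hub_pair_of_extremal:
  assumes wf: "wheel_free G" and n: "card (pverts G) \<ge> 4"
    and S: "S \<subseteq> pverts G" "S \<noteq> {}" "\<And>v. v \<in> S \<Longrightarrow> nbrs G v \<noteq> {} \<and> nbrs G v \<subseteq> S"
    and tree: "\<And>v. v \<in> S \<Longrightarrow> card (parcs G \<inter> nbrs G v \<times> nbrs G v) = 2 * (card (nbrs G v) - 1)"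
    and join: "\<And>v u. v \<in> S \<Longrightarrow> u \<in> nbrs G v \<Longrightarrow> non_nbrs v \<subseteq> nbrs G u"
  shows "\<exists>a b. hub_pair G a b"
proof -
  obtain v where v: "v \<in> S" using S by auto
  \<comment> \<open>A vertex of \<open>S\<close> has distance at most 2 from every vertex, and \<open>S\<close> is closed under neighbours.\<close>
  have SV: "S = pverts G"
  proof
    show "pverts G \<subseteq> S"
    proof
      fix w assume w: "w \<in> pverts G"
      obtain u where u: "u \<in> nbrs G v" using S(3)[OF v] by auto
      then show "w \<in> S" using w v S(3)[OF v] S(3)[of u] join[OF v u] by blast
    qed
  qed (rule S(1))
  have sub: "nbrs G x \<subseteq> nbrs G y" if "x \<in> pverts G" "y \<in> pverts G" "y \<notin> nbrs G x" for x y
    using that join[of x] nbrs_sym SV by blast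
  have twins: "nbrs G x = nbrs G y" if "x \<in> pverts G" "y \<in> pverts G" "y \<notin> nbrs G x" for x y
    using sub[of x y] sub[of y x] that nbrs_sym by blast
  \<comment> \<open>If \<open>v\<close> had a single neighbour \<open>u\<close>, then \<open>G\<close> would be a star centred at \<open>u\<close>, and \<open>N(u)\<close> would span no edge.\<close>
  have deg: "card (nbrs G v) \<noteq> 1"
  proof
    assume "card (nbrs G v) = 1"
    then obtain u where u: "nbrs G v = {u}" by (auto simp: card_1_singleton_iff)
    have leaf: "nbrs G w = {u}" if "w \<in> pverts G" "w \<noteq> u" for w
      using twins[of v w] that u v SV by auto
    have uV: "u \<in> pverts G" using u nbrs_subset by blast
    have "nbrs G u = pverts G - {u}"
      using leaf nbrs_subset[of u] nbrs_sym[of _ u] by auto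
    moreover have "card (pverts G - {u}) = card (pverts G) - 1" using uV by simp
    ultimately have "card (parcs G \<inter> nbrs G u \<times> nbrs G u) > 0"
      using tree[of u] uV SV n by simp
    then obtain x y where "(x, y) \<in> parcs G" "x \<in> nbrs G u" "y \<in> nbrs G u"
      by (metis (no_types, lifting) IntE SigmaE card.empty ex_in_conv less_irrefl)
    moreover from this have "x \<noteq> u" "y \<noteq> u" by auto
    ultimately have "y \<in> nbrs G x" "x \<in> pverts G" "x \<noteq> u" "y \<noteq> u"
      using nbrs_subset[of u] by (auto simp: nbrs_def)
    then show False using leaf[of x] by auto
  qed
  moreover have "card (nbrs G v) \<noteq> 0" using S(3)[OF v] by simp
  ultimately have "card (parcs G \<inter> nbrs G v \<times> nbrs G v) > 0"
    using tree[OF v] by linarith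
  then obtain u w where "(u, w) \<in> parcs G" and uw: "u \<in> nbrs G v" "w \<in> nbrs G v"
    by (metis (no_types, lifting) IntE SigmaE card.empty ex_in_conv less_irrefl)
  then have uw': "w \<in> nbrs G u" by (simp add: nbrs_def)
  \<comment> \<open>Of the parts containing \<open>a\<close> and \<open>b\<close>, one is a single vertex; otherwise \<open>c\<close> is the centre of a wheel with rim \<open>a b a' b'\<close>.\<close>
  have parts: "pverts G \<subseteq> insert a (nbrs G a) \<or> pverts G \<subseteq> insert b (nbrs G b)"
    if abc: "b \<in> nbrs G a" "c \<in> nbrs G a" "c \<in> nbrs G b" for a b c
  proof (rule ccontr)
    assume "\<not> ?thesis"
    then obtain a' b' where a': "a' \<in> pverts G" "a' \<noteq> a" "a' \<notin> nbrs G a"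
      and b': "b' \<in> pverts G" "b' \<noteq> b" "b' \<notin> nbrs G b" by auto
    have "a \<in> pverts G" "b \<in> pverts G" using abc nbrs_subset nbrs_sym by blast+
    then have eq: "nbrs G a' = nbrs G a" "nbrs G b' = nbrs G b" using twins a' b' by metis+
    have "{a, b, a', b'} \<subseteq> nbrs G c" using abc eq nbrs_sym by blast
    moreover have "b \<in> nbrs G a" "a' \<in> nbrs G b" "b' \<in> nbrs G a'" "a \<in> nbrs G b'"
      using abc eq nbrs_sym by blast+
    ultimately show False using no_W5[OF wf, of a b a' b' c] a' b' by auto
  qed
  have vu: "v \<in> nbrs G u" "v \<in> nbrs G w" "u \<in> nbrs G w" using uw uw' nbrs_sym by auto
  consider "pverts G \<subseteq> insert v (nbrs G v)" "pverts G \<subseteq> insert u (nbrs G u)"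
    | "pverts G \<subseteq> insert v (nbrs G v)" "pverts G \<subseteq> insert w (nbrs G w)"
    | "pverts G \<subseteq> insert u (nbrs G u)" "pverts G \<subseteq> insert w (nbrs G w)"
    using parts[of u v w] parts[of w v u] parts[of w u v] uw uw' vu by blast
  then show ?thesis
    using hub_pairI[OF wf] uw uw' by cases blast+
qed

lemma hub_pair_iso:
  assumes G: "pair_graph G" and H: "pair_graph H"
    and ab: "hub_pair G a b" and cd: "hub_pair H c d" and card: "card (pverts G) = card (pverts H)"
  shows "graph_iso G H"
proof -
  interpret G: pair_graph G by fact
  interpret H: pair_graph H by fact
  have in_verts: "a \<in> pverts G" "b \<in> pverts G" "a \<noteq> b" "c \<in> pverts H" "d \<in> pverts H" "c \<noteq> d"
    using ab cd by (auto simp: hub_pair_def)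
  have "card (pverts G - {a, b}) = card (pverts H - {c, d})"
    using in_verts card by (simp add: card_Diff_subset)
  then obtain h where h: "bij_betw h (pverts G - {a, b}) (pverts H - {c, d})"
    using finite_same_card_bij G.pair_finite_verts H.pair_finite_verts by (metis finite_Diff)
  define g where "g = h(a := c, b := d)"
  have "bij_betw g (pverts G - {a, b}) (pverts H - {c, d})"
    using h by (rule bij_betw_cong[THEN iffD1, rotated]) (auto simp: g_def)
  moreover have "bij_betw g {a, b} {c, d}" using in_verts by (auto simp: g_def bij_betw_def)
  ultimately have "bij_betw g ((pverts G - {a, b}) \<union> {a, b}) ((pverts H - {c, d}) \<union> {c, d})"
    by (rule bij_betw_combine) auto
  moreover have "(pverts G - {a, b}) \<union> {a, b} = pverts G" "(pverts H - {c, d}) \<union> {c, d} = pverts H"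
    using in_verts by auto
  ultimately have g: "bij_betw g (pverts G) (pverts H)" by simp
  have gab: "g a = c" "g b = d" using in_verts by (auto simp: g_def)
  have g_eq: "g x = g y \<longleftrightarrow> x = y" if "x \<in> pverts G" "y \<in> pverts G" for x y
    using g that by (meson bij_betw_imp_inj_on inj_on_eq_iff)
  have "g x \<in> {c, d} \<longleftrightarrow> x \<in> {a, b}" if "x \<in> pverts G" for x
    using g_eq[OF that in_verts(1)] g_eq[OF that in_verts(2)] gab by auto
  moreover have "g x \<in> pverts H" if "x \<in> pverts G" for x
    using g that by (rule bij_betwE[rule_format])
  ultimately have "(x, y) \<in> parcs G \<longleftrightarrow> (g x, g y) \<in> parcs H" if "x \<in> pverts G" "y \<in> pverts G" for x y
    using ab cd g_eq that by (simp add: hub_pair_def del: insert_iff)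
  with g show ?thesis using graph_iso_iff[OF G.wf_pair H.wf_pair] by blast
qed

lemma hub_pair_of_iso:
  assumes G: "pair_graph G" and H: "pair_graph H" and iso: "graph_iso G H" and cd: "hub_pair H c d"
  shows "\<exists>a b. hub_pair G a b"
proof -
  interpret G: pair_graph G by fact
  interpret H: pair_graph H by fact
  obtain g where g: "bij_betw g (pverts G) (pverts H)"
    and arcs: "\<And>u v. u \<in> pverts G \<Longrightarrow> v \<in> pverts G \<Longrightarrow> (u, v) \<in> parcs G \<longleftrightarrow> (g u, g v) \<in> parcs H"
    using iso graph_iso_iff[OF G.wf_pair H.wf_pair] by blast
  have "c \<in> pverts H" "d \<in> pverts H" "c \<noteq> d" using cd by (auto simp: hub_pair_def)
  then obtain a b where ab: "a \<in> pverts G" "g a = c" "b \<in> pverts G" "g b = d" "a \<noteq> b"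
    using bij_betw_imp_surj_on[OF g] by (metis imageE)
  have g_eq: "g x = g y \<longleftrightarrow> x = y" if "x \<in> pverts G" "y \<in> pverts G" for x y
    using g that by (meson bij_betw_imp_inj_on inj_on_eq_iff)
  have hub: "g x \<in> {c, d} \<longleftrightarrow> x \<in> {a, b}" if "x \<in> pverts G" for x
    using g_eq[OF that ab(1)] g_eq[OF that ab(3)] ab by auto
  have gH: "g x \<in> pverts H" if "x \<in> pverts G" for x
    using g that by (rule bij_betwE[rule_format])
  have iff: "(x, y) \<in> parcs G \<longleftrightarrow> x \<noteq> y \<and> (x \<in> {a, b} \<or> y \<in> {a, b})" if "x \<in> pverts G" "y \<in> pverts G" for x y
  proof -
    have "(g x, g y) \<in> parcs H \<longleftrightarrow> g x \<noteq> g y \<and> (g x \<in> {c, d} \<or> g y \<in> {c, d})"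
      using cd gH[OF that(1)] gH[OF that(2)] by (simp add: hub_pair_def del: insert_iff)
    then show ?thesis unfolding arcs[OF that] g_eq[OF that] hub[OF that(1)] hub[OF that(2)] .
  qed
  have "(x, y) \<in> parcs G
      \<longleftrightarrow> x \<in> pverts G \<and> y \<in> pverts G \<and> x \<noteq> y \<and> (x \<in> {a, b} \<or> y \<in> {a, b})" for x y
    using iff[of x y] G.in_arcsD1[of x y] G.in_arcsD2[of x y] by blast
  then have "hub_pair G a b"
    using ab unfolding hub_pair_def
    by (simp only: set_eq_iff split_paired_All mem_Collect_eq case_prod_conv) blast
  then show "\<exists>a b. hub_pair G a b" by blast
qed

lemma hub_pair_join:
  assumes "n \<ge> 2"
  shows "pair_graph (complete_graph 2 \<nabla> copies (n - 2) (complete_graph 1))"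
    and "card (pverts (complete_graph 2 \<nabla> copies (n - 2) (complete_graph 1))) = n"
    and "hub_pair (complete_graph 2 \<nabla> copies (n - 2) (complete_graph 1)) (Inl 0) (Inl 1)"
proof -
  let ?H = "complete_graph 2 \<nabla> copies (n - 2) (complete_graph 1)"
  show "pair_graph ?H"
    by (intro pair_graph_graph_join pair_graph_copies pair_graph_complete_graph)
  have verts: "pverts ?H = {..<2} <+> {..<n - 2} \<times> {..<1}"
    by (simp add: graph_join_def complete_graph_def copies_def)
  show "card (pverts ?H) = n"
    unfolding verts using assms by (simp add: card_Plus)
  have arcs: "(x, y) \<in> parcs ?H \<longleftrightarrow> x \<in> pverts ?H \<and> y \<in> pverts ?H \<and> x \<noteq> y
      \<and> (x \<in> {Inl 0, Inl 1} \<or> y \<in> {Inl 0, Inl 1})" for x y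
    unfolding verts
    by (cases x; cases y)
      (auto simp: graph_join_def complete_graph_def copies_def less_2_cases_iff)
  have "parcs ?H = {(x, y). x \<in> pverts ?H \<and> y \<in> pverts ?H \<and> x \<noteq> y
      \<and> (x \<in> {Inl 0, Inl 1} \<or> y \<in> {Inl 0, Inl 1})}"
    by (simp only: set_eq_iff split_paired_All mem_Collect_eq case_prod_conv) (intro allI arcs)
  moreover have "Inl 0 \<in> pverts ?H" "Inl 1 \<in> pverts ?H" unfolding verts by auto
  ultimately show "hub_pair ?H (Inl 0) (Inl 1)" unfolding hub_pair_def
    by (intro conjI; (assumption | simp))
qed

section \<open>The spectral radius of the extremal graph\<close>

definition rho_bound :: "nat \<Rightarrow> real" where
  "rho_bound n = (real n + 2 + sqrt ((real n + 2)\<^sup>2 - 16)) / 2"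

lemma rho_bound:
  assumes "n \<ge> 3"
  shows "rho_bound n * rho_bound n = (real n + 2) * rho_bound n - 4" "rho_bound n > 2"
proof -
  have "(real n + 2)\<^sup>2 \<ge> 5\<^sup>2" using assms by (intro power_mono) auto
  then have "(sqrt ((real n + 2)\<^sup>2 - 16))\<^sup>2 = (real n + 2)\<^sup>2 - 16" by simp
  moreover have "2 * rho_bound n - (real n + 2) = sqrt ((real n + 2)\<^sup>2 - 16)"
    by (simp add: rho_bound_def field_simps)
  ultimately have "(2 * rho_bound n - (real n + 2))\<^sup>2 = (real n + 2)\<^sup>2 - 16" by simp
  then show "rho_bound n * rho_bound n = (real n + 2) * rho_bound n - 4"
    by (simp add: power2_eq_square algebra_simps)
  have "sqrt ((real n + 2)\<^sup>2 - 16) \<ge> 0" using \<open>(real n + 2)\<^sup>2 \<ge> 5\<^sup>2\<close> by simp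
  moreover have "real n \<ge> 3" using assms by simp
  ultimately show "rho_bound n > 2" unfolding rho_bound_def by argo
qed

text \<open>
  A positive eigenfunction belongs to the largest eigenvalue. Here the leaves get the value 1, and the
  equation \<open>2 + 2 y = r\<close> at a leaf determines the value \<open>y\<close> at the hubs.
\<close>

lemma (in pair_graph) rho_Q_hub_pair:
  assumes ab: "hub_pair G a b" and n: "card (pverts G) = n" "n \<ge> 3"
  shows "rho_Q G = rho_bound n"
proof -
  let ?r = "rho_bound n"
  define f where "f v = (if v \<in> {a, b} then (?r - 2) / 2 else 1)" for v
  note r = rho_bound[OF n(2)]
  have in_verts: "a \<in> pverts G" "b \<in> pverts G" "a \<noteq> b" using ab by (auto simp: hub_pair_def)
  have leaf: "edge_sum G f v = ?r" if "v \<in> pverts G" "v \<notin> {a, b}" for v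
  proof -
    have "nbrs G v = {a, b}" using ab that by (auto simp: nbrs_def hub_pair_def)
    then show ?thesis using that in_verts by (simp add: edge_sum_def f_def field_simps)
  qed
  have hub: "edge_sum G f v = ?r * ((?r - 2) / 2)" if v: "v = a \<and> w = b \<or> v = b \<and> w = a" for v w
  proof -
    have nbrs: "nbrs G v = insert w (pverts G - {a, b})"
      using ab in_verts v by (auto simp: nbrs_def hub_pair_def)
    have "card (pverts G - {a, b}) = n - 2" using in_verts n by (simp add: card_Diff_subset)
    moreover have "f v = (?r - 2) / 2" "f w = (?r - 2) / 2" using v by (auto simp: f_def)
    moreover have "(\<Sum>u\<in>pverts G - {a, b}. f v + f u) = (\<Sum>u\<in>pverts G - {a, b}. ?r / 2)"
      using v by (intro sum.cong) (auto simp: f_def field_simps)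
    ultimately have "edge_sum G f v = (?r - 2) + (real n - 2) * (?r / 2)"
      unfolding edge_sum_def nbrs using v n pair_finite_verts by (subst sum.insert) auto
    then show ?thesis using r(1) by (simp add: field_simps)
  qed
  have eq: "edge_sum G f v = ?r * f v" if "v \<in> pverts G" for v
    using leaf[OF that] hub[of a b] hub[of b a] by (auto simp: f_def)
  have pos: "f v > 0" for v using r(2) by (simp add: f_def)
  have "eigenfunction G ?r f"
    unfolding eigenfunction_def using eq pos in_verts(1) by (metis less_irrefl)
  then have ge: "?r \<le> rho_Q G" using rho_Q_spectrum(2) in_verts by blast
  obtain h where h: "eigenfunction G (rho_Q G) h" using rho_Q_spectrum(1) in_verts by blast
  have "rho_Q G \<le> ?r"
  proof (rule eigenvalue_le_of_positive_supersolution(1)[OF pos _ h])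
    show "edge_sum G f v \<le> ?r * f v" if "v \<in> pverts G" for v
      using eq[OF that] by simp
  qed
  with ge show ?thesis by simp
qed

section \<open>The bound for wheel-free graphs\<close>

text \<open>
  The test vector. At an isolated vertex, where the signless Laplacian vanishes, any positive value
  does.
\<close>

definition (in pair_graph) weight :: "'a \<Rightarrow> real" where
  "weight v = (if nbrs G v = {} then 1
     else real (card (nbrs G v)) - 2 / rho_bound (card (pverts G)))"

context pair_graph begin

lemma weight_pos:
  assumes "card (pverts G) \<ge> 3"
  shows "weight v > 0"
proof -
  have "2 / rho_bound (card (pverts G)) < 1" using rho_bound(2)[OF assms] by simp
  moreover have "real (card (nbrs G v)) \<ge> 1" if "nbrs G v \<noteq> {}"
    using that by (simp add: Suc_le_eq card_gt_0_iff)
  ultimately show ?thesis unfolding weight_def by fastforce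
qed

text \<open>
  The subtracted term is the upper bound for the degree sum in \<open>sum_degrees_neighbourhood_le\<close>, equal to
  \<open>d (n + 2 - d) - 2\<close> for \<open>d = card (nbrs G v)\<close>. The constant \<open>2 / r\<close> in the weight is the only one for
  which the error term is the defect in that bound identically in \<open>d\<close>.
\<close>

lemma edge_sum_weight:
  assumes n: "card (pverts G) \<ge> 3" and v: "v \<in> pverts G" and d: "nbrs G v \<noteq> {}"
  shows "edge_sum G weight v = rho_bound (card (pverts G)) * weight v
    + real (\<Sum>u\<in>nbrs G v. card (nbrs G u))
    - real (2 * (card (nbrs G v) - 1) + card (nbrs G v) + card (nbrs G v) * card (non_nbrs v))"
proof -
  let ?d = "card (nbrs G v)" and ?n = "card (pverts G)"
  let ?r = "rho_bound ?n"
  have r: "?r * ?r = (real ?n + 2) * ?r - 4" "?r > 2" using rho_bound[OF n] .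
  define q where "q = 2 / ?r"
  have rq: "?r * q = 2" "?r = real ?n + 2 - 2 * q" using r by (simp_all add: q_def field_simps)
  have weight_v: "weight v = real ?d - q" using d by (simp add: weight_def q_def)
  have "weight u = real (card (nbrs G u)) - q" if "u \<in> nbrs G v" for u
    using that nbrs_sym by (auto simp: weight_def q_def)
  then have sum: "edge_sum G weight v = real ?d * (real ?d - q)
      + (real (\<Sum>u\<in>nbrs G v. card (nbrs G u)) - real ?d * q)"
    by (simp add: edge_sum_eq sum_subtractf weight_v)
  have "?d \<ge> 1" using d by (simp add: Suc_le_eq card_gt_0_iff)
  then have "real (2 * (?d - 1) + ?d + ?d * card (non_nbrs v))
      = 3 * real ?d - 2 + real ?d * real (card (non_nbrs v))" by (simp add: of_nat_diff)
  also have "real (card (non_nbrs v)) = real ?n - real ?d - 1"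
    using card_non_nbrs[OF v] by linarith
  finally have count: "real (2 * (?d - 1) + ?d + ?d * card (non_nbrs v))
      = 3 * real ?d - 2 + real ?d * (real ?n - real ?d - 1)" .
  have "?r * weight v = real ?d * ?r - ?r * q" by (simp add: weight_v algebra_simps)
  also have "\<dots> = real ?d * (real ?n + 2 - 2 * q) - 2"
    using rq by metis
  finally have scaled: "?r * weight v = real ?d * (real ?n + 2 - 2 * q) - 2" .
  show ?thesis unfolding sum count scaled by (simp add: algebra_simps)
qed

lemma rho_Q_wheel_free:
  assumes wf: "wheel_free G" and n: "card (pverts G) \<ge> 4"
  shows "rho_Q G \<le> rho_bound (card (pverts G))"
    and "rho_Q G = rho_bound (card (pverts G)) \<Longrightarrow> \<exists>a b. hub_pair G a b"
proof -
  let ?r = "rho_bound (card (pverts G))"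
  have n3: "card (pverts G) \<ge> 3" using n by simp
  have isolated: "edge_sum G weight v = 0" if "nbrs G v = {}" for v
    using that by (simp add: edge_sum_def)
  have r: "?r > 2" using rho_bound(2)[OF n3] .
  have le: "edge_sum G weight v \<le> ?r * weight v" if v: "v \<in> pverts G" for v
  proof (cases "nbrs G v = {}")
    case True
    then show ?thesis using isolated weight_pos[OF n3, of v] r by simp
  next
    case False
    have "real (\<Sum>u\<in>nbrs G v. card (nbrs G u))
        \<le> real (2 * (card (nbrs G v) - 1) + card (nbrs G v) + card (nbrs G v) * card (non_nbrs v))"
      using sum_degrees_neighbourhood_le(1)[OF wf v False] of_nat_le_iff by blast
    then show ?thesis using edge_sum_weight[OF n3 v False] by linarith
  qed
  have "pverts G \<noteq> {}" using n by auto
  then obtain f where f: "eigenfunction G (rho_Q G) f" using rho_Q_spectrum(1) by blast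
  note bound = eigenvalue_le_of_positive_supersolution[OF weight_pos[OF n3] le f]
  show "rho_Q G \<le> ?r" by (rule bound(1))
  assume "rho_Q G = ?r"
  then obtain S where S: "S \<subseteq> pverts G" "S \<noteq> {}"
    and eq: "\<And>v. v \<in> S \<Longrightarrow> edge_sum G weight v = ?r * weight v"
    and closed: "\<And>v. v \<in> S \<Longrightarrow> nbrs G v \<subseteq> S"
    using bound(2) by blast
  have ne: "nbrs G v \<noteq> {}" if "v \<in> S" for v
    using eq[OF that] isolated[of v] weight_pos[OF n3, of v] r by auto
  have tight: "card (parcs G \<inter> nbrs G v \<times> nbrs G v) = 2 * (card (nbrs G v) - 1)
      \<and> (\<forall>u\<in>nbrs G v. non_nbrs v \<subseteq> nbrs G u)" if v: "v \<in> S" for v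
  proof (rule sum_degrees_neighbourhood_le(2)[OF wf _ ne[OF v]])
    show vV: "v \<in> pverts G" using v S by auto
    have "real (\<Sum>u\<in>nbrs G v. card (nbrs G u))
        = real (2 * (card (nbrs G v) - 1) + card (nbrs G v) + card (nbrs G v) * card (non_nbrs v))"
      using edge_sum_weight[OF n3 vV ne[OF v]] eq[OF v] by linarith
    then show "(\<Sum>u\<in>nbrs G v. card (nbrs G u))
        = 2 * (card (nbrs G v) - 1) + card (nbrs G v) + card (nbrs G v) * card (non_nbrs v)"
      using of_nat_eq_iff by blast
  qed
  show "\<exists>a b. hub_pair G a b"
    by (rule hub_pair_of_extremal[OF wf n S]) (use ne closed tight in auto)
qed

end

theorem theorem2:
  fixes G :: "'a pair_pre_digraph" and n :: nat
  assumes "pair_graph G"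
    and "card (pverts G) = n"
    and "n \<ge> 4"
    and "wheel_free G"
  shows "rho_Q G \<le> rho_Q (complete_graph 2 \<nabla> copies (n - 2) (complete_graph 1))
    \<and> rho_Q (complete_graph 2 \<nabla> copies (n - 2) (complete_graph 1))
        = (real n + 2 + sqrt ((real n + 2)\<^sup>2 - 16)) / 2
    \<and> (rho_Q G = rho_Q (complete_graph 2 \<nabla> copies (n - 2) (complete_graph 1))
        \<longleftrightarrow> graph_iso G (complete_graph 2 \<nabla> copies (n - 2) (complete_graph 1)))"
proof -
  let ?H = "complete_graph 2 \<nabla> copies (n - 2) (complete_graph 1)"
  interpret pair_graph G by fact
  have H: "pair_graph ?H" "card (pverts ?H) = n" "hub_pair ?H (Inl 0) (Inl 1)"
    using hub_pair_join[of n] assms(3) by auto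
  have rho_H: "rho_Q ?H = rho_bound n"
    using pair_graph.rho_Q_hub_pair[OF H(1,3,2)] assms(3) by simp
  have "rho_Q G = rho_bound n \<longleftrightarrow> graph_iso G ?H"
  proof
    assume "rho_Q G = rho_bound n"
    then obtain a b where "hub_pair G a b" using rho_Q_wheel_free(2) assms by blast
    then show "graph_iso G ?H" using hub_pair_iso[OF assms(1) H(1) _ H(3)] H(2) assms(2) by simp
  next
    assume "graph_iso G ?H"
    then obtain a b where "hub_pair G a b" using hub_pair_of_iso[OF assms(1) H(1) _ H(3)] by blast
    then show "rho_Q G = rho_bound n" using rho_Q_hub_pair assms(2,3) by simp
  qed
  moreover have "rho_Q G \<le> rho_bound n" using rho_Q_wheel_free(1) assms by simp
  ultimately show ?thesis unfolding rho_H by (intro conjI rho_bound_def)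
qed

end
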